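(* Let $\mathcal{E}=(E;+,q,d,0,1)$ be a q-representable q-Jauch-Piron q-effect algebra with q-tense operators $G$ and $H$. Let $S$ be the set of all Jauch-Piron q-states on $\mathcal{E}$, and define $R_G\subseteq S\times S$ by $$sR_Gt\iff s(G(x))\leq t(x)\ \text{for all } x\in E.$$ Then $(\mathcal{E},G,H)$ can be embedded into the tense q-effect algebra $([0,1]^S,G^*,H^* )$ induced by the time frame $(S,R_G)$ and the standard q-effect algebra: the map $i:E\to[0,1]^S$, $i(x)=(s(x))_{s\in S}$, is an order reflecting morphism of q-effect algebras with $i(G(x))=G^*(i(x))$ and $i(H(x))=H^*(i(x))$ for all $x\in E$.
   Context: An effect algebra is a structure $(E;+,0,1)$ with distinguished elements $0\neq 1$ of $E$ and a partial binary operation $+$ such that for $x,y,z\in E$: (E1) if $x+y$ is defined then $y+x$ is defined and $x+y=y+x$; (E2) if $y+z$ and $x+(y+z)$ are defined then $x+y$ and $(x+y)+z$ are defined and $(x+y)+z=x+(y+z)$; (E3) for each $x$ there is a unique $x'\in E$ with $x+x'=1$; (E4) if $x+1$ is defined then $x=0$. The induced order is $x\leq y$ iff $x+z=y$ for some $z\in E$; it is a partial order with bottom $0$ and top $1$, and $x+y$ is defined iff $x\leq y'$. The dual partial operation: $x\cdot y$ is defined iff $x'\leq y$, and then $x\cdot y=(x'+y')'$. A q-effect algebra $(E;+,q,d,0,1)$ is an effect algebra with maps $q,d:E\to E$ such that for all $x,y,z\in E$: (Q1) $d(x')=q(x)'$; (Q2) $d(0)=0=q(0)$; (Q3) $d$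 is order-preserving; (Q4) $x'\leq x$ implies $x\cdot x=d(x)$; (Q5) $z\leq x$, $z\leq y$ and $y'\leq x$ imply $d(z)\leq x\cdot y$. A morphism of q-effect algebras is a map preserving $0$, $1$, $q$, $d$ and the partial operation $+$ (if $x+y$ is defined then so is the sum of the images, and it is the image of $x+y$). A map $h$ between posets is order reflecting if $h(a)\leq h(b)\iff a\leq b$. A pair $(f,g)$ of maps $f,g:E\to E$ is a Galois connection if $f(a)\leq b\iff a\leq g(b)$ for all $a,b\in E$, and a Galois q-connection if moreover $f$ and $g$ both commute with $q$ and with $d$. Unary operators $G,H:E\to E$ are q-tense operators on $\mathcal{E}$ if, with $P(x)=H(x')'$, the pair $(P,G)$ is a Galois q-connection (then, with $F(x)=G(x')'$, the pair $(F,H)$ is also a Galois q-connection). On $[0,1]$ put $a\oplus b=\min(1,a+b)$ and $a\odot b=\max(0,a+b-1)$. The standard q-effect algebra is $[0,1]$ with $a+b$ defined iff the usual sum is $\leq 1$, $q(a)=a\oplus a$, $d(a)=a\odot a$; the power $[0,1]^S$ carries componentwise operations. A q-state on $\mathcal{E}$ is a map $s:E\to[0,1]$ with $s(0)=0$, $s(1)=1$, $s(x+y)=s(x)+s(y)$ whenever $x+y$ is defined, $s(q(x))=s(x)\oplus s(x)$ and $s(d(x))=s(x)\odot s(x)$ for all $x$. A q-state $s$ is Jauch-Piron if $s(x)=1=s(y)$ implies $s(z)=1$ for some $z\in E$ with $z\leq x$ and $z\leq y$. A set of q-states on $\mathcal{E}$ is order reflecting if for all $a,b\in E$: ($s(a)\leq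 s(b)$ for all $s$ in the set) implies $a\leq b$. $\mathcal{E}$ is q-representable if it has an order reflecting set of q-states. $\mathcal{E}$ is a q-Jauch-Piron q-effect algebra if every q-state on $\mathcal{E}$ is Jauch-Piron. A time frame is a pair $(S,R)$ with $S$ a non-empty set and $R\subseteq S\times S$. The tense q-effect algebra induced by $(S,R)$ and the standard q-effect algebra is $([0,1]^S,G^*,H^* )$ where $G^*(p)(s)=\bigwedge\{p(t)\mid t\in S, sRt\}$ and $H^*(p)(s)=\bigwedge\{p(t)\mid t\in S, tRs\}$ (with $\bigwedge\emptyset=1$). *)

theory Defs
  imports Complex_Main "HOL-Library.FuncSet" "HOL-Algebra.Congruence"
begin

section \<open>Effect algebras\<close>

text \<open>The partial sum is option-valued: \<open>ea_plus A x y = Some z\<close> means that \<open>x + y\<close> is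
  defined and equal to \<open>z\<close>. Only its values on the carrier are relevant.\<close>

record 'a ea = "'a partial_object" +
  ea_plus :: "'a \<Rightarrow> 'a \<Rightarrow> 'a option"
  ea_zero :: 'a
  ea_one :: 'a

definition ea_le :: "('a, 'm) ea_scheme \<Rightarrow> 'a \<Rightarrow> 'a \<Rightarrow> bool" (infixl "\<preceq>\<index>" 50) where
  "x \<preceq>\<^bsub>A\<^esub> y \<longleftrightarrow> (\<exists>z\<in>carrier A. ea_plus A x z = Some y)"

definition ea_compl :: "('a, 'm) ea_scheme \<Rightarrow> 'a \<Rightarrow> 'a" where
  "ea_compl A x = (THE y. y \<in> carrier A \<and> ea_plus A x y = Some (ea_one A))"

definition ea_dot :: "('a, 'm) ea_scheme \<Rightarrow> 'a \<Rightarrow> 'a \<Rightarrow> 'a option" where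
  "ea_dot A x y =
     (if ea_compl A x \<preceq>\<^bsub>A\<^esub> y
      then map_option (ea_compl A) (ea_plus A (ea_compl A x) (ea_compl A y))
      else None)"

locale effect_algebra =
  fixes A :: "('a, 'm) ea_scheme"
  assumes zero_closed: "ea_zero A \<in> carrier A"
    and one_closed: "ea_one A \<in> carrier A"
    and zero_neq_one: "ea_zero A \<noteq> ea_one A"
    and plus_closed:
      "\<lbrakk>x \<in> carrier A; y \<in> carrier A; ea_plus A x y = Some z\<rbrakk> \<Longrightarrow> z \<in> carrier A"
    and plus_commute:
      "\<lbrakk>x \<in> carrier A; y \<in> carrier A; ea_plus A x y = Some z\<rbrakk> \<Longrightarrow> ea_plus A y x = Some z"
    and plus_assoc:
      "\<lbrakk>x \<in> carrier A; y \<in> carrier A; z \<in> carrier A;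
        ea_plus A y z = Some u; ea_plus A x u = Some v\<rbrakk>
       \<Longrightarrow> \<exists>w. ea_plus A x y = Some w \<and> ea_plus A w z = Some v"
    and compl_unique:
      "x \<in> carrier A \<Longrightarrow> \<exists>!y. y \<in> carrier A \<and> ea_plus A x y = Some (ea_one A)"
    and plus_one:
      "\<lbrakk>x \<in> carrier A; ea_plus A x (ea_one A) \<noteq> None\<rbrakk> \<Longrightarrow> x = ea_zero A"


section \<open>q-effect algebras\<close>

record 'a qea = "'a ea" +
  qop :: "'a \<Rightarrow> 'a"
  dop :: "'a \<Rightarrow> 'a"

locale q_effect_algebra = effect_algebra A for A :: "('a, 'm) qea_scheme" +
  assumes q_closed: "x \<in> carrier A \<Longrightarrow> qop A x \<in> carrier A"
    and d_closed: "x \<in> carrier A \<Longrightarrow> dop A x \<in> carrier A"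
    and d_compl: "x \<in> carrier A \<Longrightarrow> dop A (ea_compl A x) = ea_compl A (qop A x)"
    and d_zero: "dop A (ea_zero A) = ea_zero A"
    and q_zero: "qop A (ea_zero A) = ea_zero A"
    and d_mono:
      "\<lbrakk>x \<in> carrier A; y \<in> carrier A; x \<preceq>\<^bsub>A\<^esub> y\<rbrakk> \<Longrightarrow> dop A x \<preceq>\<^bsub>A\<^esub> dop A y"
    and dot_self:
      "\<lbrakk>x \<in> carrier A; ea_compl A x \<preceq>\<^bsub>A\<^esub> x\<rbrakk> \<Longrightarrow> ea_dot A x x = Some (dop A x)"
    and d_le_dot:
      "\<lbrakk>x \<in> carrier A; y \<in> carrier A; z \<in> carrier A;
        z \<preceq>\<^bsub>A\<^esub> x; z \<preceq>\<^bsub>A\<^esub> y; ea_compl A y \<preceq>\<^bsub>A\<^esub> x\<rbrakk>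
       \<Longrightarrow> \<exists>u. ea_dot A x y = Some u \<and> dop A z \<preceq>\<^bsub>A\<^esub> u"

definition q_morphism ::
    "('a, 'm) qea_scheme \<Rightarrow> ('b, 'n) qea_scheme \<Rightarrow> ('a \<Rightarrow> 'b) \<Rightarrow> bool" where
  "q_morphism A B h \<longleftrightarrow>
     h \<in> carrier A \<rightarrow> carrier B \<and>
     h (ea_zero A) = ea_zero B \<and>
     h (ea_one A) = ea_one B \<and>
     (\<forall>x\<in>carrier A. h (qop A x) = qop B (h x)) \<and>
     (\<forall>x\<in>carrier A. h (dop A x) = dop B (h x)) \<and>
     (\<forall>x\<in>carrier A. \<forall>y\<in>carrier A. \<forall>z.
        ea_plus A x y = Some z \<longrightarrow> ea_plus B (h x) (h y) = Some (h z))"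

definition order_reflecting_map ::
    "('a, 'm) ea_scheme \<Rightarrow> ('b, 'n) ea_scheme \<Rightarrow> ('a \<Rightarrow> 'b) \<Rightarrow> bool" where
  "order_reflecting_map A B h \<longleftrightarrow>
     (\<forall>a\<in>carrier A. \<forall>b\<in>carrier A. h a \<preceq>\<^bsub>B\<^esub> h b \<longleftrightarrow> a \<preceq>\<^bsub>A\<^esub> b)"


section \<open>q-tense operators\<close>

definition galois_pair :: "('a, 'm) ea_scheme \<Rightarrow> ('a \<Rightarrow> 'a) \<Rightarrow> ('a \<Rightarrow> 'a) \<Rightarrow> bool" where
  "galois_pair A f g \<longleftrightarrow>
     f \<in> carrier A \<rightarrow> carrier A \<and> g \<in> carrier A \<rightarrow> carrier A \<and>
     (\<forall>a\<in>carrier A. \<forall>b\<in>carrier A. f a \<preceq>\<^bsub>A\<^esub> b \<longleftrightarrow> a \<preceq>\<^bsub>A\<^esub> g b)"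

definition galois_q_pair :: "('a, 'm) qea_scheme \<Rightarrow> ('a \<Rightarrow> 'a) \<Rightarrow> ('a \<Rightarrow> 'a) \<Rightarrow> bool" where
  "galois_q_pair A f g \<longleftrightarrow>
     galois_pair A f g \<and>
     (\<forall>x\<in>carrier A. f (qop A x) = qop A (f x) \<and> f (dop A x) = dop A (f x)) \<and>
     (\<forall>x\<in>carrier A. g (qop A x) = qop A (g x) \<and> g (dop A x) = dop A (g x))"

definition q_tense_operators ::
    "('a, 'm) qea_scheme \<Rightarrow> ('a \<Rightarrow> 'a) \<Rightarrow> ('a \<Rightarrow> 'a) \<Rightarrow> bool" where
  "q_tense_operators A G H \<longleftrightarrow>
     G \<in> carrier A \<rightarrow> carrier A \<and> H \<in> carrier A \<rightarrow> carrier A \<and>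
     galois_q_pair A (\<lambda>x. ea_compl A (H (ea_compl A x))) G"


section \<open>The standard q-effect algebra, its powers, and q-states\<close>

definition luk_sum :: "real \<Rightarrow> real \<Rightarrow> real" where
  "luk_sum a b = min 1 (a + b)"

definition luk_prod :: "real \<Rightarrow> real \<Rightarrow> real" where
  "luk_prod a b = max 0 (a + b - 1)"

definition std_qea :: "real qea" where
  "std_qea =
     \<lparr>carrier = {0..1},
      ea_plus = (\<lambda>a b. if a + b \<le> 1 then Some (a + b) else None),
      ea_zero = 0,
      ea_one = 1,
      qop = (\<lambda>a. luk_sum a a),
      dop = (\<lambda>a. luk_prod a a)\<rparr>"

definition power_qea :: "('b, 'm) qea_scheme \<Rightarrow> 's set \<Rightarrow> ('s \<Rightarrow> 'b) qea" where
  "power_qea A S =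
     \<lparr>carrier = S \<rightarrow>\<^sub>E carrier A,
      ea_plus = (\<lambda>p r. if \<forall>s\<in>S. ea_plus A (p s) (r s) \<noteq> None
                       then Some (\<lambda>s\<in>S. the (ea_plus A (p s) (r s))) else None),
      ea_zero = (\<lambda>s\<in>S. ea_zero A),
      ea_one = (\<lambda>s\<in>S. ea_one A),
      qop = (\<lambda>p. \<lambda>s\<in>S. qop A (p s)),
      dop = (\<lambda>p. \<lambda>s\<in>S. dop A (p s))\<rparr>"

text \<open>States are taken to be extensional on the carrier, so that the set of all q-states contains
  exactly one function for each map from the carrier to the unit interval.\<close>

definition q_states :: "('a, 'm) qea_scheme \<Rightarrow> ('a \<Rightarrow> real) set" where
  "q_states A =
     {s \<in> carrier A \<rightarrow>\<^sub>E {0..1}.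
        s (ea_zero A) = 0 \<and> s (ea_one A) = 1 \<and>
        (\<forall>x\<in>carrier A. \<forall>y\<in>carrier A. \<forall>z. ea_plus A x y = Some z \<longrightarrow> s z = s x + s y) \<and>
        (\<forall>x\<in>carrier A. s (qop A x) = luk_sum (s x) (s x)) \<and>
        (\<forall>x\<in>carrier A. s (dop A x) = luk_prod (s x) (s x))}"

definition jauch_piron :: "('a, 'm) ea_scheme \<Rightarrow> ('a \<Rightarrow> real) \<Rightarrow> bool" where
  "jauch_piron A s \<longleftrightarrow>
     (\<forall>x\<in>carrier A. \<forall>y\<in>carrier A. s x = 1 \<and> s y = 1 \<longrightarrow>
        (\<exists>z\<in>carrier A. z \<preceq>\<^bsub>A\<^esub> x \<and> z \<preceq>\<^bsub>A\<^esub> y \<and> s z = 1))"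

definition jp_q_states :: "('a, 'm) qea_scheme \<Rightarrow> ('a \<Rightarrow> real) set" where
  "jp_q_states A = {s \<in> q_states A. jauch_piron A s}"

definition order_reflecting_states :: "('a, 'm) ea_scheme \<Rightarrow> ('a \<Rightarrow> real) set \<Rightarrow> bool" where
  "order_reflecting_states A T \<longleftrightarrow>
     (\<forall>a\<in>carrier A. \<forall>b\<in>carrier A. (\<forall>s\<in>T. s a \<le> s b) \<longrightarrow> a \<preceq>\<^bsub>A\<^esub> b)"

definition q_representable :: "('a, 'm) qea_scheme \<Rightarrow> bool" where
  "q_representable A \<longleftrightarrow> (\<exists>T \<subseteq> q_states A. order_reflecting_states A T)"

definition q_jauch_piron :: "('a, 'm) qea_scheme \<Rightarrow> bool" where
  "q_jauch_piron A \<longleftrightarrow> (\<forall>s\<in>q_states A. jauch_piron A s)"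


section \<open>Tense q-effect algebras induced by time frames\<close>

definition time_frame :: "'s set \<Rightarrow> ('s \<times> 's) set \<Rightarrow> bool" where
  "time_frame S R \<longleftrightarrow> S \<noteq> {} \<and> R \<subseteq> S \<times> S"

text \<open>Infimum in the unit interval; \<open>Inf {}\<close> is not meaningful in the reals.\<close>

definition unit_Inf :: "real set \<Rightarrow> real" where
  "unit_Inf X = (if X = {} then 1 else Inf X)"

definition G_star :: "'s set \<Rightarrow> ('s \<times> 's) set \<Rightarrow> ('s \<Rightarrow> real) \<Rightarrow> 's \<Rightarrow> real" where
  "G_star S R p = (\<lambda>s\<in>S. unit_Inf {p t | t. t \<in> S \<and> (s, t) \<in> R})"

definition H_star :: "'s set \<Rightarrow> ('s \<times> 's) set \<Rightarrow> ('s \<Rightarrow> real) \<Rightarrow> 's \<Rightarrow> real" where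
  "H_star S R p = (\<lambda>s\<in>S. unit_Inf {p t | t. t \<in> S \<and> (t, s) \<in> R})"

lemma std_simps:
  "carrier std_qea = {0..1}" "ea_zero std_qea = 0" "ea_one std_qea = 1"
  "qop std_qea = (\<lambda>a. luk_sum a a)" "dop std_qea = (\<lambda>a. luk_prod a a)"
  "ea_plus std_qea = (\<lambda>a b. if a + b \<le> 1 then Some (a + b) else None)"
  by (auto simp: std_qea_def)

lemma power_simps:
  "carrier (power_qea A S) = S \<rightarrow>\<^sub>E carrier A"
  "ea_zero (power_qea A S) = (\<lambda>s\<in>S. ea_zero A)"
  "ea_one (power_qea A S) = (\<lambda>s\<in>S. ea_one A)"
  "qop (power_qea A S) = (\<lambda>p. \<lambda>s\<in>S. qop A (p s))"
  "dop (power_qea A S) = (\<lambda>p. \<lambda>s\<in>S. dop A (p s))"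
  by (auto simp: power_qea_def)

lemma power_std_plus:
  "ea_plus (power_qea std_qea S) p r =
     (if \<forall>s\<in>S. p s + r s \<le> 1 then Some (\<lambda>s\<in>S. p s + r s) else None)"
  by (auto simp: power_qea_def std_simps intro!: restrict_ext)

lemma power_std_le:
  assumes "p \<in> S \<rightarrow>\<^sub>E {0..1}" "r \<in> S \<rightarrow>\<^sub>E {0..1}"
  shows "p \<preceq>\<^bsub>power_qea std_qea S\<^esub> r \<longleftrightarrow> (\<forall>s\<in>S. p s \<le> r s)"
proof
  assume "p \<preceq>\<^bsub>power_qea std_qea S\<^esub> r"
  then obtain z where z: "z \<in> S \<rightarrow>\<^sub>E {0..1}" "ea_plus (power_qea std_qea S) p z = Some r"
    by (auto simp: ea_le_def power_simps std_simps)
  then have "r = (\<lambda>s\<in>S. p s + z s)"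
    by (auto simp: power_std_plus split: if_splits)
  then show "\<forall>s\<in>S. p s \<le> r s"
    using PiE_mem[OF z(1)] by auto
next
  assume le: "\<forall>s\<in>S. p s \<le> r s"
  have 1: "(\<lambda>s\<in>S. r s - p s) \<in> S \<rightarrow>\<^sub>E {0..1}"
    using le PiE_mem[OF assms(1)] PiE_mem[OF assms(2)] by fastforce
  have 2: "(\<lambda>s\<in>S. p s + (\<lambda>s\<in>S. r s - p s) s) = r"
    using PiE_arb[OF assms(2)] by (intro ext) (auto simp: restrict_def)
  have "ea_plus (power_qea std_qea S) p (\<lambda>s\<in>S. r s - p s) = Some r"
    unfolding power_std_plus 2 using PiE_mem[OF assms(2)] by auto
  with 1 show "p \<preceq>\<^bsub>power_qea std_qea S\<^esub> r"
    unfolding ea_le_def power_simps std_simps by (intro bexI[of _ "\<lambda>s\<in>S. r s - p s"])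
qed

lemma power_std_compl_iff:
  assumes "p \<in> S \<rightarrow>\<^sub>E {0..1}"
  shows "y \<in> S \<rightarrow>\<^sub>E {0..1} \<and> ea_plus (power_qea std_qea S) p y = Some (\<lambda>s\<in>S. 1)
     \<longleftrightarrow> y = (\<lambda>s\<in>S. 1 - p s)" (is "?L \<longleftrightarrow> ?R")
proof
  assume L: ?L
  then have eq: "(\<lambda>s\<in>S. p s + y s) = (\<lambda>s\<in>S. 1)"
    by (auto simp: power_std_plus split: if_splits)
  show ?R
  proof (rule ext)
    fix s show "y s = (\<lambda>s\<in>S. 1 - p s) s"
      using fun_cong[OF eq, of s] PiE_arb[OF conjunct1[OF L]] by (cases "s \<in> S") auto
  qed
next
  assume ?R
  then show ?L
    using PiE_mem[OF assms] by (fastforce simp: power_std_plus restrict_def fun_eq_iff)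
qed

lemma power_std_compl:
  assumes "p \<in> S \<rightarrow>\<^sub>E {0..1}"
  shows "ea_compl (power_qea std_qea S) p = (\<lambda>s\<in>S. 1 - p s)"
  unfolding ea_compl_def power_simps std_simps
  unfolding power_std_compl_iff[OF assms] by (rule the_eq_trivial)

lemma power_std_compl_closed:
  assumes "p \<in> S \<rightarrow>\<^sub>E {0..1::real}"
  shows "(\<lambda>s\<in>S. 1 - p s) \<in> S \<rightarrow>\<^sub>E {0..1}"
  using PiE_mem[OF assms] by fastforce

lemma power_std_dot:
  assumes p: "p \<in> S \<rightarrow>\<^sub>E {0..1}" and r: "r \<in> S \<rightarrow>\<^sub>E {0..1}"
    and le: "\<forall>s\<in>S. 1 - p s \<le> r s"
  shows "ea_dot (power_qea std_qea S) p r = Some (\<lambda>s\<in>S. p s + r s - 1)"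
proof -
  note cp = power_std_compl_closed[OF p] and cr = power_std_compl_closed[OF r]
  have c: "ea_compl (power_qea std_qea S) p \<preceq>\<^bsub>power_qea std_qea S\<^esub> r"
    using le by (simp add: power_std_compl[OF p] power_std_le[OF cp r])
  have d: "ea_plus (power_qea std_qea S) (\<lambda>s\<in>S. 1 - p s) (\<lambda>s\<in>S. 1 - r s)
      = Some (\<lambda>s\<in>S. (1 - p s) + (1 - r s))"
    using le by (auto simp: power_std_plus intro!: restrict_ext)
  have "(\<lambda>s\<in>S. (1 - p s) + (1 - r s)) \<in> S \<rightarrow>\<^sub>E {0..1}"
    using le PiE_mem[OF p] PiE_mem[OF r] by fastforce
  then have "ea_compl (power_qea std_qea S) (\<lambda>s\<in>S. (1 - p s) + (1 - r s))
      = (\<lambda>s\<in>S. p s + r s - 1)"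
    by (subst power_std_compl) (auto intro!: restrict_ext)
  with c d show ?thesis
    by (simp add: ea_dot_def power_std_compl[OF p] power_std_compl[OF r])
qed

lemma power_std_q_effect_algebra:
  assumes "S \<noteq> {}"
  shows "q_effect_algebra (power_qea std_qea S)"
proof -
  let ?A = "power_qea std_qea S"
  have car: "carrier ?A = S \<rightarrow>\<^sub>E {0..1}" by (simp add: power_simps std_simps)
  have one: "ea_one ?A = (\<lambda>s\<in>S. 1)" and zero: "ea_zero ?A = (\<lambda>s\<in>S. 0)"
    by (simp_all add: power_simps std_simps)
  have ltd: "(\<lambda>s\<in>S. luk_prod (p s) (p s)) \<in> S \<rightarrow>\<^sub>E {0..1}"
    and lsd: "(\<lambda>s\<in>S. luk_sum (p s) (p s)) \<in> S \<rightarrow>\<^sub>E {0..1}"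
    if "p \<in> S \<rightarrow>\<^sub>E {0..1}" for p
    using PiE_mem[OF that] by (fastforce simp: luk_prod_def luk_sum_def)+
  show ?thesis
  proof (unfold_locales, unfold car one zero)
    show "(\<lambda>s\<in>S. 0::real) \<in> S \<rightarrow>\<^sub>E {0..1}" "(\<lambda>s\<in>S. 1::real) \<in> S \<rightarrow>\<^sub>E {0..1}" by auto
    show "(\<lambda>s\<in>S. 0::real) \<noteq> (\<lambda>s\<in>S. 1)"
    proof
      assume eq: "(\<lambda>s\<in>S. 0::real) = (\<lambda>s\<in>S. 1)"
      obtain s where "s \<in> S" using assms by auto
      then show False using fun_cong[OF eq, of s] by simp
    qed
  next
    fix x y z assume xy: "x \<in> S \<rightarrow>\<^sub>E {0..1}" "y \<in> S \<rightarrow>\<^sub>E {0..1}" "ea_plus ?A x y = Some z"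
    show "z \<in> S \<rightarrow>\<^sub>E {0..1}"
      using xy(3) PiE_mem[OF xy(1)] PiE_mem[OF xy(2)]
      by (fastforce simp: power_std_plus split: if_splits)
    show "ea_plus ?A y x = Some z"
      using xy(3) by (auto simp: power_std_plus add.commute split: if_splits)
  next
    fix x y z u v
    assume a: "x \<in> S \<rightarrow>\<^sub>E {0..1}" "y \<in> S \<rightarrow>\<^sub>E {0..1}" "z \<in> S \<rightarrow>\<^sub>E {0..1}"
      "ea_plus ?A y z = Some u" "ea_plus ?A x u = Some v"
    have u: "u = (\<lambda>s\<in>S. y s + z s)"
      and v: "v = (\<lambda>s\<in>S. x s + u s)" "\<forall>s\<in>S. x s + u s \<le> 1"
      using a(4,5) by (auto simp: power_std_plus split: if_splits)
    have le: "\<forall>s\<in>S. x s + y s + z s \<le> 1" using u v(2) by (auto simp: add.assoc)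
    have le2: "\<forall>s\<in>S. x s + y s \<le> 1" using le PiE_mem[OF a(3)] by fastforce
    show "\<exists>w. ea_plus ?A x y = Some w \<and> ea_plus ?A w z = Some v"
      using le le2 u v(1) by (auto simp: power_std_plus add.assoc intro!: restrict_ext)
  next
    fix x :: "'a \<Rightarrow> real" assume x: "x \<in> S \<rightarrow>\<^sub>E {0..1}"
    show "\<exists>!y. y \<in> S \<rightarrow>\<^sub>E {0..1} \<and> ea_plus ?A x y = Some (\<lambda>s\<in>S. 1)"
      using power_std_compl_iff[OF x] by auto
  next
    fix x assume x: "x \<in> S \<rightarrow>\<^sub>E {0..1}" "ea_plus ?A x (\<lambda>s\<in>S. 1) \<noteq> None"
    then have "\<forall>s\<in>S. x s \<le> 0" by (auto simp: power_std_plus split: if_splits)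
    then have "\<forall>s\<in>S. x s = 0" using PiE_mem[OF x(1)] by force
    then show "x = (\<lambda>s\<in>S. 0)" using PiE_arb[OF x(1)] by (auto simp: fun_eq_iff)
  next
    fix x :: "'a \<Rightarrow> real" assume x: "x \<in> S \<rightarrow>\<^sub>E {0..1}"
    show "qop ?A x \<in> S \<rightarrow>\<^sub>E {0..1}" "dop ?A x \<in> S \<rightarrow>\<^sub>E {0..1}"
      using ltd[OF x] lsd[OF x] by (simp_all add: power_simps std_simps)
    show "dop ?A (ea_compl ?A x) = ea_compl ?A (qop ?A x)"
      using lsd[OF x] power_std_compl[OF x] power_std_compl[OF lsd[OF x]]
      by (auto simp: power_simps std_simps luk_sum_def luk_prod_def intro!: restrict_ext)
  next
    show "dop ?A (\<lambda>s\<in>S. 0) = (\<lambda>s\<in>S. 0)" "qop ?A (\<lambda>s\<in>S. 0) = (\<lambda>s\<in>S. 0)"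
      by (auto simp: power_simps std_simps luk_sum_def luk_prod_def intro!: restrict_ext)
  next
    fix x y assume a: "x \<in> S \<rightarrow>\<^sub>E {0..1}" "y \<in> S \<rightarrow>\<^sub>E {0..1}" "x \<preceq>\<^bsub>?A\<^esub> y"
    then have "\<forall>s\<in>S. x s \<le> y s" by (simp add: power_std_le)
    then show "dop ?A x \<preceq>\<^bsub>?A\<^esub> dop ?A y"
      unfolding power_simps std_simps
      by (subst power_std_le[OF ltd[OF a(1)] ltd[OF a(2)]]) (fastforce simp: luk_prod_def)
  next
    fix x assume a: "x \<in> S \<rightarrow>\<^sub>E {0..1}" "ea_compl ?A x \<preceq>\<^bsub>?A\<^esub> x"
    then have le: "\<forall>s\<in>S. 1 - x s \<le> x s"
      using power_std_le[OF power_std_compl_closed[OF a(1)] a(1)]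
      by (simp add: power_std_compl)
    then show "ea_dot ?A x x = Some (dop ?A x)"
      by (subst power_std_dot[OF a(1) a(1) le])
         (auto simp: power_simps std_simps luk_prod_def intro!: restrict_ext)
  next
    fix x y z assume a: "x \<in> S \<rightarrow>\<^sub>E {0..1}" "y \<in> S \<rightarrow>\<^sub>E {0..1}" "z \<in> S \<rightarrow>\<^sub>E {0..1}"
      "z \<preceq>\<^bsub>?A\<^esub> x" "z \<preceq>\<^bsub>?A\<^esub> y" "ea_compl ?A y \<preceq>\<^bsub>?A\<^esub> x"
    have zx: "\<forall>s\<in>S. z s \<le> x s" and zy: "\<forall>s\<in>S. z s \<le> y s"
      using a by (simp_all add: power_std_le)
    have yx: "\<forall>s\<in>S. 1 - y s \<le> x s"
      using a(6) power_std_le[OF power_std_compl_closed[OF a(2)] a(1)]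
      by (simp add: power_std_compl[OF a(2)])
    then have xy: "\<forall>s\<in>S. 1 - x s \<le> y s" by (auto simp: algebra_simps)
    have m: "(\<lambda>s\<in>S. x s + y s - 1) \<in> S \<rightarrow>\<^sub>E {0..1}"
      using xy PiE_mem[OF a(1)] PiE_mem[OF a(2)] by fastforce
    have "dop ?A z \<preceq>\<^bsub>?A\<^esub> (\<lambda>s\<in>S. x s + y s - 1)"
      unfolding power_simps std_simps
      by (subst power_std_le[OF ltd[OF a(3)] m]) (use zx zy xy in \<open>fastforce simp: luk_prod_def\<close>)
    then show "\<exists>u. ea_dot ?A x y = Some u \<and> dop ?A z \<preceq>\<^bsub>?A\<^esub> u"
      using power_std_dot[OF a(1,2) xy] by auto
  qed
qed

lemma unit_Inf_ge_iff:
  assumes "X \<subseteq> {0..1}" "c \<le> 1"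
  shows "c \<le> unit_Inf X \<longleftrightarrow> (\<forall>x\<in>X. c \<le> x)"
proof (cases "X = {}")
  case False
  have "bdd_below X" using assms(1) by (auto intro!: bdd_belowI[of _ 0])
  with False show ?thesis by (simp add: unit_Inf_def le_cInf_iff)
qed (simp add: unit_Inf_def assms(2))

lemma unit_Inf_mem:
  assumes "X \<subseteq> {0..1}"
  shows "unit_Inf X \<in> {0..1}"
proof (cases "X = {}")
  case False
  then obtain x where "x \<in> X" by auto
  moreover have "unit_Inf X \<le> x"
    using \<open>x \<in> X\<close> assms False
    by (auto simp: unit_Inf_def subset_iff intro!: cInf_lower bdd_belowI[of _ 0])
  moreover have "0 \<le> unit_Inf X" using assms by (subst unit_Inf_ge_iff) auto
  ultimately show ?thesis using assms by (force simp: subset_iff)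
qed (simp add: unit_Inf_def)

lemma unit_Inf_image:
  assumes X: "X \<subseteq> {0..1}" and f: "f ` {0..1} \<subseteq> {0..1}"
    and adj: "\<And>a b. \<lbrakk>a \<in> {0..1}; b \<in> {0..1}\<rbrakk> \<Longrightarrow> a \<le> f b \<longleftrightarrow> g a \<le> b"
    and g: "\<And>a. a \<in> {0..1} \<Longrightarrow> g a \<le> 1"
  shows "unit_Inf (f ` X) = f (unit_Inf X)"
proof -
  have fX: "f ` X \<subseteq> {0..1}" using X f by auto
  have I: "unit_Inf X \<in> {0..1}" and J: "unit_Inf (f ` X) \<in> {0..1}"
    using unit_Inf_mem[OF X] unit_Inf_mem[OF fX] .
  have fI: "f (unit_Inf X) \<in> {0..1}" using I f by blast
  have iff: "c \<le> unit_Inf (f ` X) \<longleftrightarrow> c \<le> f (unit_Inf X)" if c: "c \<in> {0..1}" for c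
  proof -
    have "c \<le> unit_Inf (f ` X) \<longleftrightarrow> (\<forall>x\<in>X. c \<le> f x)"
      using unit_Inf_ge_iff[OF fX] c by auto
    also have "\<dots> \<longleftrightarrow> (\<forall>x\<in>X. g c \<le> x)" using adj[OF c] X by (meson subsetD)
    also have "\<dots> \<longleftrightarrow> g c \<le> unit_Inf X" using unit_Inf_ge_iff[OF X g[OF c]] by simp
    finally show ?thesis using adj[OF c I] by simp
  qed
  show ?thesis using iff[OF J] iff[OF fI] by simp
qed

lemma unit_Inf_luk:
  assumes "X \<subseteq> {0..1}"
  shows "unit_Inf ((\<lambda>a. luk_sum a a) ` X) = luk_sum (unit_Inf X) (unit_Inf X)"
    and "unit_Inf ((\<lambda>a. luk_prod a a) ` X) = luk_prod (unit_Inf X) (unit_Inf X)"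
proof -
  show "unit_Inf ((\<lambda>a. luk_sum a a) ` X) = luk_sum (unit_Inf X) (unit_Inf X)"
    by (rule unit_Inf_image[OF assms, where g = "\<lambda>c. c / 2"]) (auto simp: luk_sum_def)
  show "unit_Inf ((\<lambda>a. luk_prod a a) ` X) = luk_prod (unit_Inf X) (unit_Inf X)"
    by (rule unit_Inf_image[OF assms, where g = "\<lambda>c. if c = 0 then 0 else (c + 1) / 2"])
       (auto simp: luk_prod_def)
qed

lemma G_star_eq: "G_star S R p = (\<lambda>s\<in>S. unit_Inf (p ` {t \<in> S. (s, t) \<in> R}))"
  unfolding G_star_def by (intro restrict_ext arg_cong[of _ _ unit_Inf]) auto

lemma H_star_eq: "H_star S R p = G_star S (R\<inverse>) p"
  unfolding G_star_def H_star_def by auto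

lemma G_star_closed:
  assumes "p \<in> S \<rightarrow>\<^sub>E {0..1}"
  shows "G_star S R p \<in> S \<rightarrow>\<^sub>E {0..1}"
proof -
  have "p ` {t \<in> S. (s, t) \<in> R} \<subseteq> {0..1}" for s using assms by auto
  then have "unit_Inf (p ` {t \<in> S. (s, t) \<in> R}) \<in> {0..1}" for s by (rule unit_Inf_mem)
  then show ?thesis unfolding G_star_eq by auto
qed

lemma G_star_luk:
  assumes p: "p \<in> S \<rightarrow>\<^sub>E {0..1}"
  shows "G_star S R (\<lambda>s\<in>S. luk_sum (p s) (p s))
         = (\<lambda>s\<in>S. luk_sum (G_star S R p s) (G_star S R p s))"
    and "G_star S R (\<lambda>s\<in>S. luk_prod (p s) (p s))
         = (\<lambda>s\<in>S. luk_prod (G_star S R p s) (G_star S R p s))"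
proof -
  have sub: "p ` {t \<in> S. (s, t) \<in> R} \<subseteq> {0..1}" for s using p by auto
  have im: "(\<lambda>s\<in>S. f (p s)) ` {t \<in> S. (s, t) \<in> R} = f ` p ` {t \<in> S. (s, t) \<in> R}"
    for s and f :: "real \<Rightarrow> real" by (auto simp: image_iff)
  show "G_star S R (\<lambda>s\<in>S. luk_sum (p s) (p s))
         = (\<lambda>s\<in>S. luk_sum (G_star S R p s) (G_star S R p s))"
    unfolding G_star_eq im[of "\<lambda>a. luk_sum a a"] unit_Inf_luk[OF sub]
    by (auto intro!: restrict_ext)
  show "G_star S R (\<lambda>s\<in>S. luk_prod (p s) (p s))
         = (\<lambda>s\<in>S. luk_prod (G_star S R p s) (G_star S R p s))"
    unfolding G_star_eq im[of "\<lambda>a. luk_prod a a"] unit_Inf_luk[OF sub]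
    by (auto intro!: restrict_ext)
qed

lemma induced_q_tense_operators:
  assumes "time_frame S R"
  shows "q_effect_algebra (power_qea std_qea S)"
    and "q_tense_operators (power_qea std_qea S) (G_star S R) (H_star S R)"
proof -
  let ?A = "power_qea std_qea S"
  show "q_effect_algebra ?A"
    using assms by (intro power_std_q_effect_algebra) (auto simp: time_frame_def)
  have car: "carrier ?A = S \<rightarrow>\<^sub>E {0..1}" by (simp add: power_simps std_simps)
  define c where "c p = (\<lambda>s\<in>S. 1 - p s)" for p :: "'a \<Rightarrow> real"
  define P where "P p = c (G_star S (R\<inverse>) (c p))" for p
  have c: "c p \<in> S \<rightarrow>\<^sub>E {0..1}" if "p \<in> S \<rightarrow>\<^sub>E {0..1}" for p
    using power_std_compl_closed[OF that] by (simp add: c_def)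
  have P_closed: "P p \<in> S \<rightarrow>\<^sub>E {0..1}" if "p \<in> S \<rightarrow>\<^sub>E {0..1}" for p
    unfolding P_def by (intro c G_star_closed that)
  have P_eq: "ea_compl ?A (H_star S R (ea_compl ?A p)) = P p" if "p \<in> S \<rightarrow>\<^sub>E {0..1}" for p
    using c[OF that] power_std_compl[OF G_star_closed[OF c[OF that]]]
    by (simp add: P_def c_def H_star_eq power_std_compl[OF that])
  have gal: "P a \<preceq>\<^bsub>?A\<^esub> b \<longleftrightarrow> a \<preceq>\<^bsub>?A\<^esub> G_star S R b"
    if a: "a \<in> S \<rightarrow>\<^sub>E {0..1}" and b: "b \<in> S \<rightarrow>\<^sub>E {0..1}" for a b
  proof -
    have sub: "c a ` {t \<in> S. (s, t) \<in> R\<inverse>} \<subseteq> {0..1}" "b ` {t \<in> S. (s, t) \<in> R} \<subseteq> {0..1}" for s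
      using c[OF a] b by auto
    have "P a \<preceq>\<^bsub>?A\<^esub> b \<longleftrightarrow> (\<forall>s\<in>S. P a s \<le> b s)"
      using power_std_le[OF P_closed[OF a] b] .
    also have "\<dots> \<longleftrightarrow> (\<forall>s\<in>S. 1 - b s \<le> unit_Inf (c a ` {t \<in> S. (s, t) \<in> R\<inverse>}))"
      by (auto simp: P_def c_def[where p = "restrict _ _"] G_star_eq algebra_simps)
    also have "\<dots> \<longleftrightarrow> (\<forall>s\<in>S. \<forall>t\<in>S. (t, s) \<in> R \<longrightarrow> a t \<le> b s)"
    proof (intro ball_cong refl)
      fix s assume "s \<in> S"
      then have "1 - b s \<le> 1" using PiE_mem[OF b] by auto
      from unit_Inf_ge_iff[OF sub(1) this]
      show "1 - b s \<le> unit_Inf (c a ` {t \<in> S. (s, t) \<in> R\<inverse>})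
            \<longleftrightarrow> (\<forall>t\<in>S. (t, s) \<in> R \<longrightarrow> a t \<le> b s)"
        by (auto simp: c_def)
    qed
    also have "\<dots> \<longleftrightarrow> (\<forall>t\<in>S. \<forall>s\<in>S. (t, s) \<in> R \<longrightarrow> a t \<le> b s)" by blast
    also have "\<dots> \<longleftrightarrow> (\<forall>t\<in>S. a t \<le> G_star S R b t)"
    proof (intro ball_cong refl)
      fix t assume t: "t \<in> S"
      then have "a t \<le> 1" using PiE_mem[OF a] by auto
      from unit_Inf_ge_iff[OF sub(2) this] t
      show "(\<forall>s\<in>S. (t, s) \<in> R \<longrightarrow> a t \<le> b s) \<longleftrightarrow> a t \<le> G_star S R b t"
        by (auto simp: G_star_eq)
    qed
    also have "\<dots> \<longleftrightarrow> a \<preceq>\<^bsub>?A\<^esub> G_star S R b"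
      using power_std_le[OF a G_star_closed[OF b]] by simp
    finally show ?thesis .
  qed
  define Q D where "Q p = (\<lambda>s\<in>S. luk_sum (p s) (p s))"
    and "D p = (\<lambda>s\<in>S. luk_prod (p s) (p s))" for p :: "'a \<Rightarrow> real"
  have ops: "qop ?A = Q" "dop ?A = D"
    by (auto simp: power_simps std_simps Q_def D_def)
  have QD: "Q p \<in> S \<rightarrow>\<^sub>E {0..1}" "D p \<in> S \<rightarrow>\<^sub>E {0..1}" if "p \<in> S \<rightarrow>\<^sub>E {0..1}" for p
    using PiE_mem[OF that] by (fastforce simp: Q_def D_def luk_prod_def luk_sum_def)+
  have cQ: "c (Q p) = D (c p)" and cD: "c (D p) = Q (c p)" for p
    by (auto simp: c_def Q_def D_def luk_prod_def luk_sum_def intro!: restrict_ext)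
  have GQ: "G_star S T (Q p) = Q (G_star S T p)" and GD: "G_star S T (D p) = D (G_star S T p)"
    if "p \<in> S \<rightarrow>\<^sub>E {0..1}" for T p
    using G_star_luk[OF that, of T] by (simp_all add: Q_def D_def)
  have PQ: "P (Q p) = Q (P p)" and PD: "P (D p) = D (P p)" if "p \<in> S \<rightarrow>\<^sub>E {0..1}" for p
    by (simp_all add: P_def cQ cD GQ GD c that)
  have H_star_closed: "H_star S R p \<in> S \<rightarrow>\<^sub>E {0..1}" if "p \<in> S \<rightarrow>\<^sub>E {0..1}" for p
    unfolding H_star_eq by (rule G_star_closed[OF that])
  show "q_tense_operators ?A (G_star S R) (H_star S R)"
    unfolding q_tense_operators_def galois_q_pair_def galois_pair_def car ops
    by (intro conjI ballI Pi_I)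
       (simp_all add: P_eq gal P_closed PQ PD GQ GD QD G_star_closed H_star_closed)
qed

section \<open>The canonical time frame of Jauch-Piron q-states\<close>

definition state_rel ::
    "('a, 'm) qea_scheme \<Rightarrow> ('a \<Rightarrow> 'a) \<Rightarrow> (('a \<Rightarrow> real) \<times> ('a \<Rightarrow> real)) set" where
  "state_rel A G =
     {(s, t) \<in> jp_q_states A \<times> jp_q_states A. \<forall>x\<in>carrier A. s (G x) \<le> t x}"

definition state_embedding :: "('a \<Rightarrow> real) set \<Rightarrow> 'a \<Rightarrow> ('a \<Rightarrow> real) \<Rightarrow> real" where
  "state_embedding S x = (\<lambda>s\<in>S. s x)"

end

theory Submission
  imports Defs "HOL-Analysis.Function_Topology"
begin

text \<open>
  The substance of the theorem is the identity
  \<open>s (G x) = inf {t x | t. s R t}\<close> for every q-state \<open>s\<close>; the embedding and order-reflection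
  claims only unfold representability. The inequality \<open>\<le>\<close> is the definition of \<open>R\<close>. For
  \<open>\<ge>\<close>, given \<open>c \<le> 1\<close> above \<open>s (G x)\<close>, a q-state \<open>t\<close> must be found that dominates
  \<open>m = s \<circ> G\<close> everywhere and still satisfies \<open>t x < c\<close>.

  The function \<open>m\<close> need not be additive, but it is monotone, commutes with \<open>q\<close> and \<open>d\<close>, and,
  because \<open>G\<close> has a left adjoint and \<open>s\<close> is Jauch-Piron, the set \<open>F = {f. m f = 1}\<close> is
  down-directed. Two ideas turn this into the required state.

  First, composites of \<open>q\<close> and \<open>d\<close> act on the unit interval so expansively that any two reals
  \<open>a < b\<close> are sent to \<open>0\<close> and \<open>1\<close> by one of them (\<open>std_word_separation\<close>). Since
  \<open>m\<close> and all q-states commute with these composites, comparing them at arbitrary values reduces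
  to comparing where they take the values \<open>0\<close> and \<open>1\<close>: it is enough to find \<open>t\<close> that is
  \<open>1\<close> on \<open>F\<close> and \<open>0\<close> at a given \<open>y\<close> with \<open>m y = 0\<close>.

  Secondly, such a \<open>t\<close> exists by compactness of the space of q-states
  (\<open>exists_state_separating\<close>). For \<open>f\<close> in \<open>F\<close> the element \<open>d\<^sup>n f\<close> still has
  \<open>m\<close>-value \<open>1\<close> and \<open>q\<^sup>n y\<close> still has \<open>m\<close>-value \<open>0\<close>, so
  \<open>d\<^sup>n f \<le> q\<^sup>n y\<close> fails, and order reflection gives a q-state that is within
  \<open>1 / 2\<^sup>n\<close> of \<open>1\<close> at \<open>f\<close> and of \<open>0\<close> at \<open>y\<close>. Directedness of \<open>F\<close> makes
  the corresponding closed sets of states a family with the finite intersection property.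

  The identity for \<open>H\<close> is the same result for the dual Galois connection, once
  \<open>state_rel_converse\<close> shows that the relation defined from \<open>H\<close> is the converse of the one
  defined from \<open>G\<close>.
\<close>

section \<open>Separating reals in the unit interval by words in q and d\<close>

text \<open>
  Composites of \<open>q\<close> and \<open>d\<close> are named by words, so that the same composite can be formed
  in an arbitrary algebra and in the standard one, and a state carries the first to the second.
\<close>

fun qd_word :: "('a, 'm) qea_scheme \<Rightarrow> bool list \<Rightarrow> 'a \<Rightarrow> 'a" where
  "qd_word A [] x = x"
| "qd_word A (b # w) x = qd_word A w (if b then qop A x else dop A x)"

lemma std_word_mono: "a \<le> b \<Longrightarrow> qd_word std_qea w a \<le> qd_word std_qea w b"
  by (induction w arbitrary: a b) (auto simp: std_simps luk_sum_def luk_prod_def)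

lemma std_d_power:
  assumes "0 \<le> a" "a \<le> 1"
  shows "qd_word std_qea (replicate n False) a = max 0 (1 - 2 ^ n * (1 - a))"
  using assms
proof (induction n arbitrary: a)
  case (Suc n)
  have "qd_word std_qea (replicate (Suc n) False) a = max 0 (1 - 2 ^ n * (1 - luk_prod a a))"
    using Suc.IH[of "luk_prod a a"] Suc.prems by (auto simp: std_simps luk_prod_def)
  also have "\<dots> = max 0 (1 - 2 ^ Suc n * (1 - a))"
  proof (cases "2 * a \<ge> 1")
    case False
    then have "1 * 1 \<le> 2 ^ n * (2 * (1 - a))" by (intro mult_mono) auto
    then have "1 \<le> 2 ^ Suc n * (1 - a)"
      by (simp add: mult_ac del: right_diff_distrib_numeral left_diff_distrib_numeral)
    moreover have "luk_prod a a = 0" using False by (simp add: luk_prod_def)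
    ultimately show ?thesis by (auto simp: max_def intro: antisym)
  qed (simp add: luk_prod_def algebra_simps)
  finally show ?case .
qed auto

lemma std_q_power:
  assumes "0 \<le> a" "a \<le> 1"
  shows "qd_word std_qea (replicate n True) a = min 1 (2 ^ n * a)"
  using assms
proof (induction n arbitrary: a)
  case (Suc n)
  have "qd_word std_qea (replicate (Suc n) True) a = min 1 (2 ^ n * luk_sum a a)"
    using Suc.IH[of "luk_sum a a"] Suc.prems by (auto simp: std_simps luk_sum_def)
  also have "\<dots> = min 1 (2 ^ Suc n * a)"
  proof (cases "2 * a \<le> 1")
    case False
    then have "1 * 1 \<le> 2 ^ n * (2 * a)" by (intro mult_mono) auto
    then have "1 \<le> 2 ^ Suc n * a" by (simp add: mult_ac)
    moreover have "luk_sum a a = 1" using False by (simp add: luk_sum_def)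
    ultimately show ?thesis by (simp add: min_def)
  qed (simp add: luk_sum_def algebra_simps)
  finally show ?case .
qed auto

text \<open>
  On the lower half of the interval \<open>q\<close> doubles distances, and on the upper half \<open>d\<close> does, so
  as long as \<open>a\<close> and \<open>b\<close> lie in the same half one letter doubles their gap; this can happen only
  finitely often. Once \<open>1/2\<close> separates them, \<open>q\<close> moves \<open>b\<close> to the common fixed point
  \<open>1\<close> while \<open>a\<close> stays below it, and iterating \<open>d\<close> pushes \<open>a\<close> down to \<open>0\<close>.
\<close>

lemma std_word_separation:
  assumes "0 \<le> a" "a < b" "b \<le> 1"
  obtains w where "qd_word std_qea w a = 0" "qd_word std_qea w b = 1"
proof -
  have ex: "\<exists>w. qd_word std_qea w a = 0 \<and> qd_word std_qea w b = 1"
    if "0 \<le> a" "a < b" "b \<le> 1" "1 \<le> 2 ^ n * (b - a)" for a b n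
    using that
  proof (induction n arbitrary: a b)
    case 0
    then have "a = 0" "b = 1" by auto
    then show ?case by (intro exI[of _ "[]"]) simp
  next
    case (Suc n)
    consider "b \<le> 1/2" | "1/2 \<le> a" | "a < 1/2" "1/2 < b" by linarith
    then show ?case
    proof cases
      case 1
      then have "\<exists>w. qd_word std_qea w (2 * a) = 0 \<and> qd_word std_qea w (2 * b) = 1"
        using Suc.prems by (intro Suc.IH) (auto simp: algebra_simps)
      then obtain w where "qd_word std_qea w (2 * a) = 0" "qd_word std_qea w (2 * b) = 1" by blast
      then show ?thesis
        using 1 Suc.prems by (intro exI[of _ "True # w"]) (simp add: std_simps luk_sum_def)
    next
      case 2
      then have "\<exists>w. qd_word std_qea w (2 * a - 1) = 0 \<and> qd_word std_qea w (2 * b - 1) = 1"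
        using Suc.prems by (intro Suc.IH) (auto simp: algebra_simps)
      then obtain w where "qd_word std_qea w (2 * a - 1) = 0" "qd_word std_qea w (2 * b - 1) = 1"
        by blast
      then show ?thesis
        using 2 Suc.prems by (intro exI[of _ "False # w"]) (simp add: std_simps luk_prod_def)
    next
      case 3
      obtain k where "1 / (1 - 2 * a) < 2 ^ k"
        using real_arch_pow[of 2 "1 / (1 - 2 * a)"] by auto
      then have "1 < 2 ^ k * (1 - 2 * a)" using 3 by (simp add: field_simps)
      then show ?thesis
        using 3 Suc.prems std_d_power[of "2 * a" k] std_d_power[of 1 k]
        by (intro exI[of _ "True # replicate k False"]) (auto simp: std_simps luk_sum_def min_def)
    qed
  qed
  obtain n where "1 / (b - a) < 2 ^ n"
    using real_arch_pow[of 2 "1 / (b - a)"] by auto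
  then have "1 \<le> 2 ^ n * (b - a)" using assms by (simp add: field_simps)
  then show ?thesis using ex assms that by blast
qed

section \<open>The compact space of q-states\<close>

lemma q_statesD:
  assumes "s \<in> q_states A"
  shows "x \<in> carrier A \<Longrightarrow> s x \<in> {0..1}"
    and "s (ea_zero A) = 0" "s (ea_one A) = 1"
    and "\<lbrakk>x \<in> carrier A; y \<in> carrier A; ea_plus A x y = Some z\<rbrakk> \<Longrightarrow> s z = s x + s y"
    and "x \<in> carrier A \<Longrightarrow> s (qop A x) = luk_sum (s x) (s x)"
    and "x \<in> carrier A \<Longrightarrow> s (dop A x) = luk_prod (s x) (s x)"
  using assms unfolding q_states_def by (auto dest: PiE_mem)

lemma q_state_mono:
  assumes "s \<in> q_states A" "x \<in> carrier A" "x \<preceq>\<^bsub>A\<^esub> y"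
  shows "s x \<le> s y"
  using assms q_statesD(1,4)[OF assms(1)] unfolding ea_le_def by fastforce

text \<open>
  In the topology of pointwise convergence the states form a closed subset of a product of compact
  spaces, since every defining condition is an equation between continuous functions of finitely
  many coordinates.
\<close>

lemma compact_q_states: "compact (q_states A)"
proof -
  \<comment> \<open>Outside the carrier an extensional function takes the value \<open>undefined\<close>, so those factors
    are points and the product over all indices is compact.\<close>
  define K where "K x = (if x \<in> carrier A then {0..1} else {undefined :: real})" for x
  have "compactin (product_topology (\<lambda>_. euclidean) UNIV) (PiE UNIV K)"
    by (subst compactin_PiE) (auto simp: K_def)
  then have K: "compact (PiE UNIV K)"
    by (simp add: euclidean_product_topology)
  have pr: "continuous_on UNIV (\<lambda>s::'a \<Rightarrow> real. s x)" for x
    by simp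
  have "closed {s::'a \<Rightarrow> real. s (ea_zero A) = 0 \<and> s (ea_one A) = 1 \<and>
        (\<forall>x\<in>carrier A. \<forall>y\<in>carrier A. \<forall>z. ea_plus A x y = Some z \<longrightarrow> s z = s x + s y) \<and>
        (\<forall>x\<in>carrier A. s (qop A x) = luk_sum (s x) (s x)) \<and>
        (\<forall>x\<in>carrier A. s (dop A x) = luk_prod (s x) (s x))}" (is "closed ?C")
    unfolding luk_sum_def luk_prod_def Ball_def
    by (intro closed_Collect_conj closed_Collect_all closed_Collect_imp closed_Collect_eq
        open_Collect_const continuous_intros pr)
  with K have "compact (PiE UNIV K \<inter> ?C)" by blast
  moreover have "PiE UNIV K = carrier A \<rightarrow>\<^sub>E {0..1}"
    by (auto simp: K_def PiE_iff extensional_def split: if_splits)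
  ultimately show ?thesis
    by (simp add: q_states_def Collect_conj_eq Int_assoc)
qed

section \<open>Semistates are infima of q-states\<close>

text \<open>
  The properties of a q-state that survive composition with a right adjoint commuting with \<open>q\<close>
  and \<open>d\<close>. Additivity is lost; monotonicity and directedness of the elements of value \<open>1\<close>
  take its place.
\<close>

definition q_semistate :: "('a, 'm) qea_scheme \<Rightarrow> ('a \<Rightarrow> real) \<Rightarrow> bool" where
  "q_semistate A m \<longleftrightarrow>
     m \<in> carrier A \<rightarrow> {0..1} \<and> m (ea_one A) = 1 \<and>
     (\<forall>x\<in>carrier A. \<forall>y\<in>carrier A. x \<preceq>\<^bsub>A\<^esub> y \<longrightarrow> m x \<le> m y) \<and>
     (\<forall>x\<in>carrier A. m (qop A x) = luk_sum (m x) (m x)) \<and>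
     (\<forall>x\<in>carrier A. m (dop A x) = luk_prod (m x) (m x)) \<and>
     jauch_piron A m"

lemma q_state_semistate:
  assumes "s \<in> q_states A" "jauch_piron A s"
  shows "q_semistate A s"
  using assms q_statesD[OF assms(1)] q_state_mono[OF assms(1)]
  unfolding q_semistate_def by (auto simp del: atLeastAtMost_iff)

locale q_representable_qea = q_effect_algebra A for A :: "('a, 'm) qea_scheme" +
  assumes representable: "q_representable A"
begin

text \<open>
  With this equivalence, facts about the order reduce to facts about real numbers and are obtained
  without developing the general arithmetic of effect algebras.
\<close>

lemma le_iff_states:
  assumes "x \<in> carrier A" "y \<in> carrier A"
  shows "x \<preceq>\<^bsub>A\<^esub> y \<longleftrightarrow> (\<forall>s\<in>q_states A. s x \<le> s y)"
  using assms representable q_state_mono[of _ A x y]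
  unfolding q_representable_def order_reflecting_states_def by (meson subsetD)

lemma compl_closed: "x \<in> carrier A \<Longrightarrow> ea_compl A x \<in> carrier A"
  and plus_compl: "x \<in> carrier A \<Longrightarrow> ea_plus A x (ea_compl A x) = Some (ea_one A)"
  using theI'[OF compl_unique] unfolding ea_compl_def by blast+

lemma compl_compl: "x \<in> carrier A \<Longrightarrow> ea_compl A (ea_compl A x) = x"
  using compl_unique[of "ea_compl A x"] compl_closed plus_compl plus_commute by metis

lemma state_compl: "\<lbrakk>s \<in> q_states A; x \<in> carrier A\<rbrakk> \<Longrightarrow> s (ea_compl A x) = 1 - s x"
  using q_statesD(3,4) compl_closed plus_compl by (metis add_diff_cancel_left')

lemma q_compl: "x \<in> carrier A \<Longrightarrow> qop A (ea_compl A x) = ea_compl A (dop A x)"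
  using d_compl[of "ea_compl A x"] compl_closed compl_compl q_closed by metis

text \<open>
  Without states, order reflection would force \<open>1 \<le> 0\<close>; but only \<open>0\<close> can be added to
  \<open>1\<close>, and \<open>1 + 0 = 1\<close>.
\<close>

lemma q_states_nonempty: "q_states A \<noteq> {}"
proof
  assume "q_states A = {}"
  then have "ea_one A \<preceq>\<^bsub>A\<^esub> ea_zero A"
    using le_iff_states one_closed zero_closed by simp
  then obtain z where z: "z \<in> carrier A" "ea_plus A (ea_one A) z = Some (ea_zero A)"
    by (auto simp: ea_le_def)
  have summand: "y = ea_zero A" if "y \<in> carrier A" "ea_plus A (ea_one A) y = Some v" for y v
    using plus_commute[OF one_closed that] plus_one[OF that(1)] by simp
  have "ea_compl A (ea_one A) = ea_zero A"
    using summand compl_closed plus_compl one_closed by blast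
  then have "ea_plus A (ea_one A) (ea_zero A) = Some (ea_one A)"
    using plus_compl[OF one_closed] by simp
  then show False using z summand[OF z] zero_neq_one by simp
qed

lemma word_closed: "x \<in> carrier A \<Longrightarrow> qd_word A w x \<in> carrier A"
  by (induction w arbitrary: x) (auto simp: q_closed d_closed)

lemma semistate_word:
  assumes "q_semistate A m" "x \<in> carrier A"
  shows "m (qd_word A w x) = qd_word std_qea w (m x)"
  using assms(2)
proof (induction w arbitrary: x)
  case (Cons b w)
  then show ?case
    using assms(1) q_closed d_closed by (auto simp: q_semistate_def std_simps)
qed auto

lemma state_word:
  assumes "s \<in> q_states A" "x \<in> carrier A"
  shows "s (qd_word A w x) = qd_word std_qea w (s x)"
  using assms(2)
proof (induction w arbitrary: x)
  case (Cons b w)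
  then show ?case
    using q_statesD(5,6)[OF assms(1)] q_closed d_closed by (auto simp: std_simps)
qed auto

text \<open>
  Applying \<open>d\<close> repeatedly to \<open>f\<close> and \<open>q\<close> to \<open>y\<close> does not change their \<open>m\<close>-values,
  so \<open>d\<^sup>n f \<le> q\<^sup>n y\<close> fails and some state \<open>t\<close> witnesses this. Then
  \<open>t (d\<^sup>n f) > 0\<close> and \<open>t (q\<^sup>n y) < 1\<close>, which are the two estimates.
\<close>

lemma exists_state_almost_separating:
  assumes m: "q_semistate A m" and f: "f \<in> carrier A" "m f = 1" and y: "y \<in> carrier A" "m y = 0"
  obtains t where "t \<in> q_states A" "1 - 1 / 2 ^ n \<le> t f" "t y \<le> 1 / 2 ^ n"
proof -
  let ?f = "qd_word A (replicate n False) f" and ?y = "qd_word A (replicate n True) y"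
  have "m ?f = 1" "m ?y = 0"
    using f y by (simp_all add: semistate_word[OF m] std_d_power std_q_power)
  moreover have "m ?f \<le> m ?y" if "?f \<preceq>\<^bsub>A\<^esub> ?y"
    using m word_closed[OF f(1)] word_closed[OF y(1)] that unfolding q_semistate_def by blast
  ultimately have "\<not> ?f \<preceq>\<^bsub>A\<^esub> ?y" by auto
  then obtain t where t: "t \<in> q_states A" "t ?y < t ?f"
    using le_iff_states word_closed f y by (meson not_le)
  have b: "0 \<le> t f" "t f \<le> 1" "0 \<le> t y" "t y \<le> 1"
    using q_statesD(1)[OF t(1)] f y by auto
  have "min 1 (2 ^ n * t y) < max 0 (1 - 2 ^ n * (1 - t f))"
    using t f y b by (simp add: state_word std_d_power std_q_power)
  moreover have "0 \<le> 2 ^ n * t y" "0 \<le> 2 ^ n * (1 - t f)" using b by auto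
  ultimately have "2 ^ n * t y \<le> 1" "2 ^ n * (1 - t f) \<le> 1" by (auto simp: min_def max_def split: if_splits)
  then have "t y \<le> 1 / 2 ^ n" "1 - 1 / 2 ^ n \<le> t f" by (simp_all add: field_simps)
  with t(1) show ?thesis using that by blast
qed

text \<open>
  The approximately separating states for all \<open>f\<close> and all precisions form closed sets in the
  compact space of q-states. Finitely many of them meet, because by the Jauch-Piron property of
  \<open>m\<close> finitely many \<open>f\<close> of \<open>m\<close>-value \<open>1\<close> have a common lower bound of
  \<open>m\<close>-value \<open>1\<close>, and a state close to \<open>1\<close> there is close to \<open>1\<close> above it.
\<close>

lemma exists_state_separating:
  assumes m: "q_semistate A m" and y: "y \<in> carrier A" "m y = 0"
  obtains t where "t \<in> q_states A" "\<And>f. \<lbrakk>f \<in> carrier A; m f = 1\<rbrakk> \<Longrightarrow> t f = 1" "t y = 0"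
proof -
  let ?F = "{f \<in> carrier A. m f = 1}"
  define C where "C = (\<lambda>(f, n::nat). {t :: 'a \<Rightarrow> real. 1 - 1 / 2 ^ n \<le> t f \<and> t y \<le> 1 / 2 ^ n})"
  have directed: "\<exists>g\<in>?F. \<exists>k. \<forall>p\<in>I. g \<preceq>\<^bsub>A\<^esub> fst p \<and> snd p \<le> k"
    if "finite I" "I \<subseteq> ?F \<times> UNIV" for I :: "('a \<times> nat) set"
    using that
  proof (induction I rule: finite_induct)
    case empty
    then show ?case using m one_closed by (auto simp: q_semistate_def)
  next
    case (insert p I)
    then obtain g k where g: "g \<in> ?F" "\<forall>p\<in>I. g \<preceq>\<^bsub>A\<^esub> fst p \<and> snd p \<le> k" by blast
    have p: "fst p \<in> ?F" using insert.prems by auto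
    obtain h where h: "h \<in> ?F" "h \<preceq>\<^bsub>A\<^esub> g" "h \<preceq>\<^bsub>A\<^esub> fst p"
      using m g(1) p unfolding q_semistate_def jauch_piron_def by blast
    have "h \<preceq>\<^bsub>A\<^esub> fst r" if "r \<in> I" for r
    proof -
      have r: "fst r \<in> carrier A" "g \<preceq>\<^bsub>A\<^esub> fst r" using that insert.prems g by auto
      with h g(1) show ?thesis by (fastforce simp: le_iff_states intro: order_trans)
    qed
    then show ?case
      using h g(2) by (intro bexI[of _ h] exI[of _ "max k (snd p)"]) (auto intro: le_max_iff_disj[THEN iffD2])
  qed
  have "q_states A \<inter> \<Inter> (C ` (?F \<times> UNIV)) \<noteq> {}"
  proof (rule compact_imp_fip[OF compact_q_states])
    fix T assume "T \<in> C ` (?F \<times> UNIV)"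
    then show "closed T"
      by (auto simp: C_def intro!: closed_Collect_conj closed_Collect_le continuous_intros)
  next
    fix \<F>' assume "finite \<F>'" "\<F>' \<subseteq> C ` (?F \<times> UNIV)"
    then obtain I where I: "I \<subseteq> ?F \<times> UNIV" "finite I" "\<F>' = C ` I"
      by (meson finite_subset_image)
    obtain g k where g: "g \<in> ?F" "\<And>f n. (f, n) \<in> I \<Longrightarrow> g \<preceq>\<^bsub>A\<^esub> f \<and> n \<le> k"
      using directed[OF I(2,1)] by fastforce
    obtain t where t: "t \<in> q_states A" "1 - 1 / 2 ^ k \<le> t g" "t y \<le> 1 / 2 ^ k"
      using exists_state_almost_separating[OF m _ _ y, of g k] g(1) by blast
    have "t \<in> C (f, n)" if "(f, n) \<in> I" for f n
    proof -
      have "t g \<le> t f" using q_state_mono[OF t(1)] g that by blast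
      moreover have "1 / 2 ^ k \<le> (1::real) / 2 ^ n"
        using g(2)[OF that] by (intro divide_left_mono power_increasing) auto
      ultimately show ?thesis using t by (simp add: C_def)
    qed
    then show "q_states A \<inter> \<Inter> \<F>' \<noteq> {}" using t(1) I(3) by auto
  qed
  then obtain t where t: "t \<in> q_states A" "\<And>f n. f \<in> ?F \<Longrightarrow> t \<in> C (f, n)" by auto
  have small: "e \<le> 0" if "\<And>n. e \<le> 1 / 2 ^ n" for e :: real
  proof (rule LIMSEQ_le_const)
    show "(\<lambda>n. 1 / 2 ^ n :: real) \<longlonglongrightarrow> 0" by (rule LIMSEQ_divide_realpow_zero) simp
  qed (use that in auto)
  show ?thesis
  proof (rule that[OF t(1)])
    fix f assume f: "f \<in> carrier A" "m f = 1"
    have "1 - t f \<le> 0"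
    proof (rule small)
      fix n show "1 - t f \<le> 1 / 2 ^ n" using t(2)[of f n] f by (auto simp: C_def)
    qed
    then show "t f = 1" using q_statesD(1)[OF t(1) f(1)] by auto
  next
    have "t y \<le> 0"
    proof (rule small)
      fix n show "t y \<le> 1 / 2 ^ n"
        using t(2)[of "ea_one A" n] m one_closed by (auto simp: C_def q_semistate_def)
    qed
    then show "t y = 0" using q_statesD(1)[OF t(1) y(1)] by auto
  qed
qed

text \<open>
  A word separating \<open>m x\<close> from \<open>c\<close> reduces \<open>t x < c\<close> to \<open>t\<close> vanishing at an
  element of \<open>m\<close>-value \<open>0\<close>. If \<open>t\<close> fell below \<open>m\<close> at some \<open>y\<close>, a word
  separating \<open>t y\<close> from \<open>m y\<close> would produce an element with \<open>m\<close>-value \<open>1\<close> and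
  \<open>t\<close>-value \<open>0\<close>.
\<close>

lemma exists_state_above_semistate:
  assumes m: "q_semistate A m" and x: "x \<in> carrier A" "m x < c" "c \<le> 1"
  obtains t where "t \<in> q_states A" "\<And>y. y \<in> carrier A \<Longrightarrow> m y \<le> t y" "t x < c"
proof -
  have m01: "0 \<le> m y" "m y \<le> 1" if "y \<in> carrier A" for y
    using m that by (auto simp: q_semistate_def)
  obtain w where w: "qd_word std_qea w (m x) = 0" "qd_word std_qea w c = 1"
    using std_word_separation[of "m x" c] m01 x by blast
  have "m (qd_word A w x) = 0" using semistate_word[OF m] x w by simp
  then obtain t where t: "t \<in> q_states A" "\<And>f. \<lbrakk>f \<in> carrier A; m f = 1\<rbrakk> \<Longrightarrow> t f = 1"
      "t (qd_word A w x) = 0"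
    using exists_state_separating[OF m word_closed[OF x(1)]] by metis
  show ?thesis
  proof (rule that[OF t(1)])
    fix y assume y: "y \<in> carrier A"
    show "m y \<le> t y"
    proof (rule ccontr)
      assume "\<not> m y \<le> t y"
      then obtain v where v: "qd_word std_qea v (t y) = 0" "qd_word std_qea v (m y) = 1"
        using std_word_separation[of "t y" "m y"] m01[OF y] q_statesD(1)[OF t(1) y] by auto
      then have "t (qd_word A v y) = 1"
        using t(2) word_closed y semistate_word[OF m] by simp
      with v state_word[OF t(1) y] show False by simp
    qed
  next
    show "t x < c"
    proof (rule ccontr)
      assume "\<not> t x < c"
      then have "qd_word std_qea w c \<le> qd_word std_qea w (t x)" by (intro std_word_mono) simp
      with w t(3) state_word[OF t(1) x(1)] show False by simp
    qed
  qed
qed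

lemma semistate_eq_unit_Inf:
  assumes m: "q_semistate A m" and x: "x \<in> carrier A"
  shows "m x = unit_Inf {t x | t. t \<in> q_states A \<and> (\<forall>y\<in>carrier A. m y \<le> t y)}"
    (is "_ = unit_Inf ?X")
proof -
  have X: "?X \<subseteq> {0..1}" using q_statesD(1)[OF _ x] by blast
  have "m x \<le> 1" using m x by (auto simp: q_semistate_def)
  then have "m x \<le> unit_Inf ?X" using x unit_Inf_ge_iff[OF X] by auto
  moreover have "\<not> m x < unit_Inf ?X"
  proof
    assume less: "m x < unit_Inf ?X"
    have le1: "unit_Inf ?X \<le> 1" using unit_Inf_mem[OF X] by simp
    obtain t where t: "t \<in> q_states A" "\<And>y. y \<in> carrier A \<Longrightarrow> m y \<le> t y" "t x < unit_Inf ?X"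
      using exists_state_above_semistate[OF m x less le1] by blast
    then have "t x \<in> ?X" by blast
    then show False using t(3) unit_Inf_ge_iff[OF X le1] by fastforce
  qed
  ultimately show ?thesis by simp
qed

section \<open>Right adjoints and the canonical time frame\<close>

lemma galois_pairD:
  assumes g: "galois_pair A f g"
  shows "x \<in> carrier A \<Longrightarrow> f x \<in> carrier A" "x \<in> carrier A \<Longrightarrow> g x \<in> carrier A"
    and "x \<in> carrier A \<Longrightarrow> x \<preceq>\<^bsub>A\<^esub> g (f x)"
    and "x \<in> carrier A \<Longrightarrow> f (g x) \<preceq>\<^bsub>A\<^esub> x"
    and "\<lbrakk>x \<in> carrier A; y \<in> carrier A\<rbrakk> \<Longrightarrow> f x \<preceq>\<^bsub>A\<^esub> y \<longleftrightarrow> x \<preceq>\<^bsub>A\<^esub> g y"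
proof -
  show f: "f x \<in> carrier A" and g': "g x \<in> carrier A" if "x \<in> carrier A" for x
    using g that by (auto simp: galois_pair_def)
  show iff: "f x \<preceq>\<^bsub>A\<^esub> y \<longleftrightarrow> x \<preceq>\<^bsub>A\<^esub> g y" if "x \<in> carrier A" "y \<in> carrier A" for x y
    using g that by (auto simp: galois_pair_def)
  show "x \<preceq>\<^bsub>A\<^esub> g (f x)" "f (g x) \<preceq>\<^bsub>A\<^esub> x" if "x \<in> carrier A" for x
    using iff[of x "f x"] iff[of "g x" x] that f g' by (auto simp: le_iff_states)
qed

text \<open>
  The only delicate point is directedness. If \<open>s\<close> is \<open>1\<close> at \<open>g x\<close> and \<open>g y\<close>, it is
  \<open>1\<close> at some common lower bound \<open>z\<close> of these; then \<open>f z\<close> lies below \<open>x\<close> and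
  \<open>y\<close>, and \<open>s\<close> is \<open>1\<close> at \<open>g (f z)\<close>, which lies above \<open>z\<close>.
\<close>

lemma semistate_right_adjoint:
  assumes g: "galois_pair A f g" and s: "q_semistate A s"
    and q: "\<And>x. x \<in> carrier A \<Longrightarrow> g (qop A x) = qop A (g x)"
    and d: "\<And>x. x \<in> carrier A \<Longrightarrow> g (dop A x) = dop A (g x)"
  shows "q_semistate A (\<lambda>x. s (g x))"
proof -
  note gal = galois_pairD[OF g]
  have s01: "s x \<in> {0..1}" if "x \<in> carrier A" for x
    using s that by (auto simp: q_semistate_def)
  have s_mono: "s x \<le> s y" if "x \<in> carrier A" "y \<in> carrier A" "x \<preceq>\<^bsub>A\<^esub> y" for x y
    using s that by (auto simp: q_semistate_def)
  have s_one: "s (ea_one A) = 1" using s by (simp add: q_semistate_def)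
  have trans: "x \<preceq>\<^bsub>A\<^esub> z"
    if "x \<preceq>\<^bsub>A\<^esub> y" "y \<preceq>\<^bsub>A\<^esub> z" "x \<in> carrier A" "y \<in> carrier A" "z \<in> carrier A" for x y z
    using that by (fastforce simp: le_iff_states intro: order_trans)
  have mono: "s (g x) \<le> s (g y)" if "x \<in> carrier A" "y \<in> carrier A" "x \<preceq>\<^bsub>A\<^esub> y" for x y
  proof -
    have "g x \<preceq>\<^bsub>A\<^esub> g y" using gal(1,2,4,5) trans[OF gal(4)] that by blast
    then show ?thesis using s_mono gal(2) that by blast
  qed
  have "f (ea_one A) \<preceq>\<^bsub>A\<^esub> ea_one A"
    using gal(1) one_closed q_statesD(1,3) by (fastforce simp: le_iff_states)
  then have "s (ea_one A) \<le> s (g (ea_one A))"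
    using gal(2,5) one_closed s_mono by blast
  then have one: "s (g (ea_one A)) = 1" using s_one s01[OF gal(2)[OF one_closed]] by auto
  have "jauch_piron A (\<lambda>x. s (g x))"
    unfolding jauch_piron_def
  proof (intro ballI impI)
    fix x y assume xy: "x \<in> carrier A" "y \<in> carrier A" "s (g x) = 1 \<and> s (g y) = 1"
    then obtain z where z: "z \<in> carrier A" "z \<preceq>\<^bsub>A\<^esub> g x" "z \<preceq>\<^bsub>A\<^esub> g y" "s z = 1"
      using s gal(2) unfolding q_semistate_def jauch_piron_def by blast
    have "s z \<le> s (g (f z))" using s_mono gal(1-3) z(1) by blast
    then have "s (g (f z)) = 1" using z s01[OF gal(2)[OF gal(1)[OF z(1)]]] by auto
    then show "\<exists>z\<in>carrier A. z \<preceq>\<^bsub>A\<^esub> x \<and> z \<preceq>\<^bsub>A\<^esub> y \<and> s (g z) = 1"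
      using z gal(1,5) xy by blast
  qed
  then show ?thesis
    using s01 gal(2) one mono s q d unfolding q_semistate_def by (auto simp del: atLeastAtMost_iff)
qed

lemma state_right_adjoint_eq_unit_Inf:
  assumes "galois_pair A f g" "s \<in> q_states A" "jauch_piron A s" "x \<in> carrier A"
    and "\<And>x. x \<in> carrier A \<Longrightarrow> g (qop A x) = qop A (g x)"
    and "\<And>x. x \<in> carrier A \<Longrightarrow> g (dop A x) = dop A (g x)"
  shows "s (g x) = unit_Inf {t x | t. t \<in> q_states A \<and> (\<forall>y\<in>carrier A. s (g y) \<le> t y)}"
  using semistate_eq_unit_Inf[OF semistate_right_adjoint[OF assms(1) q_state_semistate]] assms
  by simp

text \<open>
  Conjugating the adjunction by the complement exchanges the roles of \<open>G\<close> and \<open>H\<close>, and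
  conjugating by the complement also exchanges \<open>q\<close> and \<open>d\<close>.
\<close>

lemma dual_galois_q_pair:
  assumes "q_tense_operators A G H"
  shows "galois_pair A (\<lambda>x. ea_compl A (G (ea_compl A x))) H"
    and "x \<in> carrier A \<Longrightarrow> H (qop A x) = qop A (H x)"
    and "x \<in> carrier A \<Longrightarrow> H (dop A x) = dop A (H x)"
proof -
  let ?c = "ea_compl A"
  have G: "G x \<in> carrier A" and H: "H x \<in> carrier A" if "x \<in> carrier A" for x
    using assms that by (auto simp: q_tense_operators_def)
  have gq: "galois_q_pair A (\<lambda>x. ?c (H (?c x))) G"
    using assms by (simp add: q_tense_operators_def)
  have anti: "?c x \<preceq>\<^bsub>A\<^esub> y \<longleftrightarrow> ?c y \<preceq>\<^bsub>A\<^esub> x" if "x \<in> carrier A" "y \<in> carrier A" for x y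
    using that by (auto simp: le_iff_states compl_closed state_compl algebra_simps)
  have "?c (G (?c a)) \<preceq>\<^bsub>A\<^esub> b \<longleftrightarrow> a \<preceq>\<^bsub>A\<^esub> H b" if a: "a \<in> carrier A" and b: "b \<in> carrier A" for a b
  proof -
    have "?c (G (?c a)) \<preceq>\<^bsub>A\<^esub> b \<longleftrightarrow> ?c b \<preceq>\<^bsub>A\<^esub> G (?c a)"
      using anti G compl_closed a b by blast
    also have "\<dots> \<longleftrightarrow> ?c (H (?c (?c b))) \<preceq>\<^bsub>A\<^esub> ?c a"
      using gq a b compl_closed by (auto simp: galois_q_pair_def galois_pair_def)
    also have "\<dots> \<longleftrightarrow> ?c (?c a) \<preceq>\<^bsub>A\<^esub> H b"
      using anti[OF H[OF b] compl_closed[OF a]] by (simp add: b compl_compl)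
    finally show ?thesis using a by (simp add: compl_compl)
  qed
  then show "galois_pair A (\<lambda>x. ?c (G (?c x))) H"
    unfolding galois_pair_def using G H compl_closed by auto
  have P: "?c (H (?c (qop A y))) = qop A (?c (H (?c y)))"
    "?c (H (?c (dop A y))) = dop A (?c (H (?c y)))" if "y \<in> carrier A" for y
    using gq that by (auto simp: galois_q_pair_def)
  show "H (qop A x) = qop A (H x)" if x: "x \<in> carrier A" for x
    using P(2)[OF compl_closed[OF x]] x H
    by (metis compl_closed compl_compl d_compl q_closed)
  show "H (dop A x) = dop A (H x)" if x: "x \<in> carrier A" for x
    using P(1)[OF compl_closed[OF x]] x H
    by (metis compl_closed compl_compl q_compl d_closed)
qed

text \<open>
  With \<open>P x = H(x')'\<close>, the unit and counit of the adjunction show that \<open>s \<circ> G \<le> t\<close> is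
  equivalent to \<open>s \<le> t \<circ> P\<close>; taking complements turns the latter into
  \<open>t \<circ> H \<le> s\<close>.
\<close>

lemma state_rel_converse:
  assumes t: "q_tense_operators A G H" and st: "s \<in> q_states A" "t \<in> q_states A"
  shows "(\<forall>x\<in>carrier A. s (G x) \<le> t x) \<longleftrightarrow> (\<forall>x\<in>carrier A. t (H x) \<le> s x)"
proof -
  let ?c = "ea_compl A"
  let ?P = "\<lambda>x. ?c (H (?c x))"
  have g: "galois_pair A ?P G"
    using t by (simp add: q_tense_operators_def galois_q_pair_def)
  note gal = galois_pairD[OF g]
  have H: "H x \<in> carrier A" if "x \<in> carrier A" for x
    using t that by (auto simp: q_tense_operators_def)
  have "(\<forall>x\<in>carrier A. s (G x) \<le> t x) \<longleftrightarrow> (\<forall>x\<in>carrier A. s x \<le> t (?P x))"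
  proof (intro iffI ballI)
    fix x assume a: "\<forall>x\<in>carrier A. s (G x) \<le> t x" and x: "x \<in> carrier A"
    show "s x \<le> t (?P x)"
      using q_state_mono[OF st(1) x gal(3)[OF x]] a gal(1)[OF x] by fastforce
  next
    fix x assume a: "\<forall>x\<in>carrier A. s x \<le> t (?P x)" and x: "x \<in> carrier A"
    show "s (G x) \<le> t x"
      using q_state_mono[OF st(2) gal(1)[OF gal(2)[OF x]] gal(4)[OF x]] a gal(2)[OF x] by fastforce
  qed
  also have "\<dots> \<longleftrightarrow> (\<forall>x\<in>carrier A. t (H (?c x)) \<le> s (?c x))"
    using st by (auto simp: state_compl H compl_closed algebra_simps)
  also have "\<dots> \<longleftrightarrow> (\<forall>x\<in>carrier A. t (H x) \<le> s x)"
    by (metis compl_closed compl_compl)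
  finally show ?thesis .
qed

section \<open>The canonical embedding\<close>

lemma state_embedding_closed:
  "x \<in> carrier A \<Longrightarrow> state_embedding (q_states A) x \<in> q_states A \<rightarrow>\<^sub>E {0..1}"
  unfolding state_embedding_def restrict_PiE_iff using q_statesD(1) by (intro ballI)

lemma state_embedding_morphism:
  "q_morphism A (power_qea std_qea (q_states A)) (state_embedding (q_states A))"
  unfolding q_morphism_def
proof (intro conjI ballI allI impI)
  fix x y z assume xyz: "x \<in> carrier A" "y \<in> carrier A" "ea_plus A x y = Some z"
  have "z \<in> carrier A" using plus_closed xyz by blast
  then have "s x + s y = s z" "s z \<le> 1" if "s \<in> q_states A" for s
    using q_statesD(1,4)[OF that] xyz by fastforce+
  then show "ea_plus (power_qea std_qea (q_states A)) (state_embedding (q_states A) x)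
      (state_embedding (q_states A) y) = Some (state_embedding (q_states A) z)"
    by (auto simp: power_std_plus state_embedding_def intro!: restrict_ext)
qed (auto simp: state_embedding_closed power_simps std_simps state_embedding_def q_statesD
    simp del: atLeastAtMost_iff intro!: restrict_ext)

lemma state_embedding_order_reflecting:
  "order_reflecting_map A (power_qea std_qea (q_states A)) (state_embedding (q_states A))"
  unfolding order_reflecting_map_def
  by (simp add: power_std_le state_embedding_closed le_iff_states)
     (simp add: state_embedding_def)

end

theorem theorem5:
  fixes E :: "('a, 'm) qea_scheme" and G H :: "'a \<Rightarrow> 'a"
  assumes "q_effect_algebra E"
    and "q_representable E"
    and "q_jauch_piron E"
    and "q_tense_operators E G H"
  shows "let S = jp_q_states E; R = state_rel E G; i = state_embedding S in
           time_frame S R \<and>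
           q_morphism E (power_qea std_qea S) i \<and>
           order_reflecting_map E (power_qea std_qea S) i \<and>
           (\<forall>x\<in>carrier E. i (G x) = G_star S R (i x)) \<and>
           (\<forall>x\<in>carrier E. i (H x) = H_star S R (i x))"
proof -
  interpret q_representable_qea E
    using assms(1,2) by (simp add: q_representable_qea_def q_representable_qea_axioms_def)
  let ?Q = "q_states E" and ?R = "state_rel E G" and ?i = "state_embedding (q_states E)"
  have S: "jp_q_states E = ?Q" and jp: "\<And>s. s \<in> ?Q \<Longrightarrow> jauch_piron E s"
    using assms(3) by (auto simp: jp_q_states_def q_jauch_piron_def)
  have gq: "galois_q_pair E (\<lambda>x. ea_compl E (H (ea_compl E x))) G"
    using assms(4) by (simp add: q_tense_operators_def)
  have R: "(s, t) \<in> ?R \<longleftrightarrow> (\<forall>x\<in>carrier E. s (G x) \<le> t x)"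
      "(s, t) \<in> ?R \<longleftrightarrow> (\<forall>x\<in>carrier E. t (H x) \<le> s x)"
    if "s \<in> ?Q" "t \<in> ?Q" for s t
    using that state_rel_converse[OF assms(4) that] by (auto simp: state_rel_def S)
  have G: "?i (G x) = G_star ?Q ?R (?i x)" if x: "x \<in> carrier E" for x
    unfolding G_star_def state_embedding_def
  proof (rule restrict_ext)
    fix s assume s: "s \<in> ?Q"
    have "s (G x) = unit_Inf {t x | t. t \<in> ?Q \<and> (\<forall>y\<in>carrier E. s (G y) \<le> t y)}"
      using gq by (intro state_right_adjoint_eq_unit_Inf s jp x) (auto simp: galois_q_pair_def)
    also have "{t x | t. t \<in> ?Q \<and> (\<forall>y\<in>carrier E. s (G y) \<le> t y)}
        = {(\<lambda>s\<in>?Q. s x) t | t. t \<in> ?Q \<and> (s, t) \<in> ?R}"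
      using R(1)[OF s] by fastforce
    finally show "s (G x) = unit_Inf {(\<lambda>s\<in>?Q. s x) t | t. t \<in> ?Q \<and> (s, t) \<in> ?R}" .
  qed
  have H: "?i (H x) = H_star ?Q ?R (?i x)" if x: "x \<in> carrier E" for x
    unfolding H_star_def state_embedding_def
  proof (rule restrict_ext)
    fix s assume s: "s \<in> ?Q"
    have "s (H x) = unit_Inf {t x | t. t \<in> ?Q \<and> (\<forall>y\<in>carrier E. s (H y) \<le> t y)}"
      by (intro state_right_adjoint_eq_unit_Inf[OF dual_galois_q_pair(1)[OF assms(4)]]
          dual_galois_q_pair(2,3)[OF assms(4)] s jp x)
    also have "{t x | t. t \<in> ?Q \<and> (\<forall>y\<in>carrier E. s (H y) \<le> t y)}
        = {(\<lambda>s\<in>?Q. s x) t | t. t \<in> ?Q \<and> (t, s) \<in> ?R}"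
      using R(2)[OF _ s] by fastforce
    finally show "s (H x) = unit_Inf {(\<lambda>s\<in>?Q. s x) t | t. t \<in> ?Q \<and> (t, s) \<in> ?R}" .
  qed
  have "time_frame ?Q ?R"
    using q_states_nonempty by (auto simp: time_frame_def state_rel_def S)
  then show ?thesis
    using state_embedding_morphism state_embedding_order_reflecting G H by (simp add: S Let_def)
qed

end
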